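(* Let $G$ be a connected graph of order $n\geqslant 3$ which is not a cycle. For every integer $k\geqslant 2$, $D(G^{\frac{1}{k+1}})\leqslant D'(G^{\frac{1}{k}})$.
   Context: Graphs are finite and simple. The $k$-subdivision $G^{\frac{1}{k}}$ is obtained by replacing each edge $uv$ of $G$ by a path of length $k$ between $u$ and $v$ with $k-1$ new internal vertices. The distinguishing number $D(H)$ (resp. index $D'(H)$) is the least $d$ such that some labeling $V(H)\to\{1,\dots,d\}$ (resp. $E(H)\to\{1,\dots,d\}$) is preserved by no non-trivial automorphism of $H$. *)

theory Defs
  imports Main "HOL-Library.FuncSet"
begin

text \<open>An edge is the unordered pair of its two ends.\<close>

type_synonym 'a graph = "'a set \<times> 'a set set"

abbreviation verts :: "'a graph \<Rightarrow> 'a set" where "verts \<equiv> fst"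
abbreviation edges :: "'a graph \<Rightarrow> 'a set set" where "edges \<equiv> snd"

definition finite_simple_graph :: "'a graph \<Rightarrow> bool" where
  "finite_simple_graph G \<longleftrightarrow>
     finite (verts G) \<and> (\<forall>e\<in>edges G. e \<subseteq> verts G \<and> card e = 2)"

definition connected_graph :: "'a graph \<Rightarrow> bool" where
  "connected_graph G \<longleftrightarrow>
     verts G \<noteq> {} \<and>
     (\<forall>u\<in>verts G. \<forall>v\<in>verts G. (\<lambda>x y. {x, y} \<in> edges G)\<^sup>*\<^sup>* u v)"

definition graph_iso :: "('a \<Rightarrow> 'b) \<Rightarrow> 'a graph \<Rightarrow> 'b graph \<Rightarrow> bool" where
  "graph_iso f G H \<longleftrightarrow>
     bij_betw f (verts G) (verts H) \<and>
     (\<forall>u\<in>verts G. \<forall>v\<in>verts G. {u, v} \<in> edges G \<longleftrightarrow> {f u, f v} \<in> edges H)"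

definition cycle_graph :: "nat \<Rightarrow> nat graph" where
  "cycle_graph n = ({..<n}, {{i, Suc i mod n} | i. i < n})"

definition is_cycle :: "'a graph \<Rightarrow> bool" where
  "is_cycle G \<longleftrightarrow> (\<exists>n\<ge>3. \<exists>f. graph_iso f G (cycle_graph n))"

text \<open>Automorphisms are total functions on the vertex type; only their values on the vertex
  set matter, so ``trivial'' means being the identity there.\<close>

abbreviation automorphism :: "('a \<Rightarrow> 'a) \<Rightarrow> 'a graph \<Rightarrow> bool" where
  "automorphism f G \<equiv> graph_iso f G G"

definition trivial_on :: "('a \<Rightarrow> 'a) \<Rightarrow> 'a graph \<Rightarrow> bool" where
  "trivial_on f G \<longleftrightarrow> (\<forall>v\<in>verts G. f v = v)"

definition distinguishing_vertex_labeling :: "'a graph \<Rightarrow> ('a \<Rightarrow> nat) \<Rightarrow> bool" where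
  "distinguishing_vertex_labeling G c \<longleftrightarrow>
     \<not> (\<exists>f. automorphism f G \<and> \<not> trivial_on f G \<and> (\<forall>v\<in>verts G. c (f v) = c v))"

definition distinguishing_edge_labeling :: "'a graph \<Rightarrow> ('a set \<Rightarrow> nat) \<Rightarrow> bool" where
  "distinguishing_edge_labeling G c \<longleftrightarrow>
     \<not> (\<exists>f. automorphism f G \<and> \<not> trivial_on f G \<and> (\<forall>e\<in>edges G. c (f ` e) = c e))"

definition distinguishing_number :: "'a graph \<Rightarrow> nat" where
  "distinguishing_number G =
     (LEAST d. \<exists>c \<in> verts G \<rightarrow> {1..d}. distinguishing_vertex_labeling G c)"

text \<open>A graph such as the single edge has no distinguishing edge labeling at all, and then the
  value below is unspecified. A finite connected graph of order at least 3 always has one.\<close>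

definition distinguishing_index :: "'a graph \<Rightarrow> nat" where
  "distinguishing_index G =
     (LEAST d. \<exists>c \<in> edges G \<rightarrow> {1..d}. distinguishing_edge_labeling G c)"

text \<open>The internal vertex of the path replacing the edge \<open>uv\<close> that lies at distance \<open>i\<close> from
  \<open>u\<close> is named by its distances to the two ends, that is by the set
  \<open>{(u, i), (v, k - i)}\<close>. This needs no choice of an orientation of the edge.\<close>

datatype 'a subdiv_vertex = Original 'a | Internal "('a \<times> nat) set"

definition subdiv_point :: "nat \<Rightarrow> 'a \<Rightarrow> 'a \<Rightarrow> nat \<Rightarrow> 'a subdiv_vertex" where
  "subdiv_point k u v i =
     (if i = 0 then Original u
      else if i = k then Original v
      else Internal {(u, i), (v, k - i)})"

definition subdivision :: "nat \<Rightarrow> 'a graph \<Rightarrow> 'a subdiv_vertex graph" where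
  "subdivision k G =
     (Original ` verts G \<union> {subdiv_point k u v i | u v i. {u, v} \<in> edges G \<and> 0 < i \<and> i < k},
      {{subdiv_point k u v i, subdiv_point k u v (Suc i)} | u v i. {u, v} \<in> edges G \<and> i < k})"

lemma subdiv_point_reverse:
  assumes "0 < k" "i \<le> k"
  shows "subdiv_point k v u (k - i) = subdiv_point k u v i"
  using assms by (auto simp: subdiv_point_def)

lemma subdiv_point_internal_eq_iff:
  assumes "u \<noteq> v" "x \<noteq> y" "0 < i" "i < k" "0 < j" "j < k"
  shows "subdiv_point k u v i = subdiv_point k x y j \<longleftrightarrow>
    (u = x \<and> v = y \<and> i = j) \<or> (u = y \<and> v = x \<and> i = k - j)"
  using assms by (auto simp: subdiv_point_def doubleton_eq_iff)

end

theory Submission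
  imports Defs
begin

text \<open>Write \<open>H k\<close> for the \<open>k\<close>-subdivision of \<open>G\<close>. The internal vertex at position \<open>i + 1\<close> of a path of
  \<open>H (k + 1)\<close> corresponds to the \<open>i\<close>-th edge of the same path of \<open>H k\<close>, so an edge labeling of \<open>H k\<close>
  labels the internal vertices of \<open>H (k + 1)\<close>; the original vertices all receive the label 1. An
  automorphism of a subdivision that sends one original vertex to an original vertex is induced by
  an automorphism of \<open>G\<close>, because the image of a path can be followed vertex by vertex. If no original
  vertex were sent to an original one, every vertex of \<open>G\<close> would have degree 2 and \<open>G\<close> would be a
  cycle. Hence a label-preserving automorphism of \<open>H (k + 1)\<close> comes from \<open>G\<close> and induces a
  label-preserving one of \<open>H k\<close>.\<close>

section \<open>Connected 2-regular graphs\<close>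

definition neighbours :: "'a graph \<Rightarrow> 'a \<Rightarrow> 'a set" where
  "neighbours G x = {y. {x, y} \<in> edges G}"

lemma neighbours_sym: "y \<in> neighbours G x \<longleftrightarrow> x \<in> neighbours G y"
  by (simp add: neighbours_def insert_commute)

lemma edge_ends:
  assumes "finite_simple_graph G" "{u, v} \<in> edges G"
  shows "u \<in> verts G" "v \<in> verts G" "u \<noteq> v"
  using assms by (auto simp: finite_simple_graph_def)

lemma finite_edges: "finite_simple_graph G \<Longrightarrow> finite (edges G)"
  unfolding finite_simple_graph_def by (meson PowI finite_Pow_iff rev_finite_subset subsetI)

lemma edge_obtain:
  assumes "finite_simple_graph G" "e \<in> edges G"
  obtains u v where "e = {u, v}" "u \<noteq> v" "u \<in> verts G" "v \<in> verts G"
proof -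
  have "card e = 2" "e \<subseteq> verts G" using assms by (auto simp: finite_simple_graph_def)
  then show thesis using that by (auto simp: card_2_iff)
qed

lemma connected_graph_induct:
  assumes "connected_graph G" "u \<in> verts G" "v \<in> verts G" "P u"
    and "\<And>x y. P x \<Longrightarrow> {x, y} \<in> edges G \<Longrightarrow> P y"
  shows "P v"
proof -
  have "(\<lambda>x y. {x, y} \<in> edges G)\<^sup>*\<^sup>* u v"
    using assms by (auto simp: connected_graph_def)
  then show ?thesis by (induction) (use assms in auto)
qed

text \<open>The walk that starts along the edge from \<open>a\<close> to \<open>b\<close> and never
  turns back. At a vertex of degree 2 that is adjacent to its predecessor, the \<open>SOME\<close>
  denotes the other neighbour.\<close>

fun walk :: "'a graph \<Rightarrow> 'a \<Rightarrow> 'a \<Rightarrow> nat \<Rightarrow> 'a" where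
  "walk G a b 0 = a"
| "walk G a b (Suc 0) = b"
| "walk G a b (Suc (Suc i)) = (SOME y. neighbours G (walk G a b (Suc i)) = {walk G a b i, y})"

text \<open>By finiteness a walk that never turns back must repeat a vertex. The first repetition
  closes up at the start, because anywhere else it would give a vertex a third neighbour. The closed
  walk contains all neighbours of its vertices, so by connectedness it reaches every vertex.\<close>

lemma two_regular_is_cycle:
  assumes fin: "finite_simple_graph G" and con: "connected_graph G"
    and deg: "\<And>v. v \<in> verts G \<Longrightarrow> card (neighbours G v) = 2"
  shows "is_cycle G"
proof -
  obtain a where a: "a \<in> verts G" using con by (auto simp: connected_graph_def)
  obtain b where b: "b \<in> neighbours G a" using deg[OF a] by fastforce
  define p where "p = walk G a b"
  have nbV: "x \<in> verts G \<and> y \<in> verts G \<and> x \<noteq> y" if "y \<in> neighbours G x" for x y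
    using that edge_ends[OF fin] by (auto simp: neighbours_def)
  have other: "\<exists>z. neighbours G y = {x, z}" if "y \<in> neighbours G x" for x y
  proof -
    have "card (neighbours G y) = 2" "x \<in> neighbours G y"
      using that nbV deg neighbours_sym by metis+
    then show ?thesis by (auto simp: card_2_iff)
  qed
  have step: "p (Suc i) \<in> neighbours G (p i)
      \<and> neighbours G (p (Suc i)) = {p i, p (Suc (Suc i))}" for i
  proof (induction i)
    case 0
    have "p (Suc 0) \<in> neighbours G (p 0)" using b by (simp add: p_def)
    then show ?case using someI_ex[OF other] by (simp add: p_def)
  next
    case (Suc i)
    have "p (Suc (Suc i)) \<in> neighbours G (p (Suc i))" using Suc by auto
    then show ?case using someI_ex[OF other] by (simp add: p_def)
  qed
  have pV: "p i \<in> verts G" for i using step nbV by metis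
  have adj: "p i \<noteq> p (Suc i)" for i using step nbV by metis
  have ne2: "p i \<noteq> p (Suc (Suc i))" for i
  proof
    assume "p i = p (Suc (Suc i))"
    then have "card (neighbours G (p (Suc i))) = 1" using step[of i] by simp
    then show False using deg[OF pV] by simp
  qed
  define rep where "rep j \<longleftrightarrow> (\<exists>i<j. p i = p j)" for j
  have "\<exists>j. rep j"
  proof (rule ccontr)
    assume "\<not> ?thesis"
    then have "inj p" unfolding rep_def inj_def by (metis linorder_neqE_nat)
    moreover have "finite (range p)"
      using pV fin finite_subset[of "range p" "verts G"] by (auto simp: finite_simple_graph_def)
    ultimately show False using finite_imageD by blast
  qed
  \<comment> \<open>As the first index whose vertex has occurred before, \<open>n\<close> makes
    \<open>p\<close> injective below it.\<close>
  define n where "n = (LEAST j. rep j)"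
  have "rep n" unfolding n_def using \<open>\<exists>j. rep j\<close> by (rule LeastI_ex)
  then obtain i where i: "i < n" "p i = p n" by (auto simp: rep_def)
  have "\<not> rep j" if "j < n" for j using that not_less_Least unfolding n_def by blast
  then have inj: "inj_on p {..<n}"
    unfolding inj_on_def rep_def by (metis lessThan_iff linorder_neqE_nat)
  \<comment> \<open>If \<open>i > 0\<close>, the neighbours of \<open>p i\<close> are
    \<open>p (i - 1)\<close> and \<open>p (i + 1)\<close>. The vertex \<open>p (n - 1)\<close> is
    also adjacent to \<open>p i = p n\<close>, so by injectivity \<open>n - 1\<close> is one of
    these two indices. The first is too small, the second would mean that the walk turns
    back.\<close>
  have "i = 0"
  proof (rule ccontr)
    assume "i \<noteq> 0"
    then obtain i' where i': "i = Suc i'" by (cases i) auto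
    obtain m where m: "n = Suc m" using i by (cases n) auto
    have "p m \<in> neighbours G (p i)" using step[of m] i m neighbours_sym by metis
    then have "p m = p i' \<or> p m = p (Suc i)" using step[of i'] i' by auto
    moreover have "m \<noteq> i" using i m adj by metis
    moreover have "Suc i \<noteq> m" using i m ne2 by metis
    ultimately show False
      using i i' m inj_on_eq_iff[OF inj, of m i'] inj_on_eq_iff[OF inj, of m "Suc i"] by auto
  qed
  then have p0: "p n = p 0" using i by simp
  have "n \<noteq> 0" "n \<noteq> 1" "n \<noteq> 2"
    using i p0 adj[of 0] ne2[of 0] by (auto simp: numeral_2_eq_2)
  then have n3: "n \<ge> 3" by simp
  \<comment> \<open>Cyclic successor and predecessor modulo \<open>n\<close>; \<open>pv\<close>
    treats 0 separately because subtraction on \<open>nat\<close> truncates.\<close>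
  define nx where "nx i = Suc i mod n" for i
  define pv where "pv i = (if i = 0 then n - 1 else i - 1)" for i
  have pnx: "p (nx i) = p (Suc i)" if "i < n" for i
    using that p0 by (cases "Suc i = n") (auto simp: nx_def)
  have nb: "neighbours G (p i) = {p (pv i), p (nx i)}" if "i < n" for i
  proof (cases i)
    case 0
    obtain m where m: "n = Suc m" using n3 by (cases n) auto
    have "p m \<in> neighbours G (p 0)" using step[of m] m p0 neighbours_sym by metis
    moreover have "p 1 \<in> neighbours G (p 0)" using step[of 0] by simp
    moreover have "p m \<noteq> p 1" using n3 m inj_on_eq_iff[OF inj, of m 1] by auto
    moreover have "card (neighbours G (p 0)) = 2" using deg pV by blast
    ultimately have "neighbours G (p 0) = {p m, p 1}" by (auto simp: card_2_iff)
    then show ?thesis using 0 m n3 by (simp add: pv_def nx_def)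
  next
    case (Suc j)
    then show ?thesis using step[of j] pnx[OF that] by (auto simp: pv_def)
  qed
  have lt: "nx i < n" "pv i < n" if "i < n" for i
    using that by (auto simp: nx_def pv_def)
  have "\<exists>i<n. p i = v" if "v \<in> verts G" for v
  proof (rule connected_graph_induct[OF con a that, where P = "\<lambda>v. \<exists>i<n. p i = v"])
    show "\<exists>i<n. p i = a" using n3 by (intro exI[of _ 0]) (simp add: p_def)
    fix x y assume "\<exists>i<n. p i = x" "{x, y} \<in> edges G"
    then obtain i where i: "i < n" "y \<in> neighbours G (p i)" by (auto simp: neighbours_def)
    then have "y = p (pv i) \<or> y = p (nx i)" using nb[OF i(1)] by simp
    then show "\<exists>i<n. p i = y" using lt[OF i(1)] by blast
  qed
  then have "bij_betw p {..<n} (verts G)"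
    using inj pV unfolding bij_betw_def by blast
  moreover have "{i, j} \<in> edges (cycle_graph n) \<longleftrightarrow> {p i, p j} \<in> edges G" if "i < n" "j < n" for i j
  proof -
    have "{p i, p j} \<in> edges G \<longleftrightarrow> p j \<in> {p (pv i), p (nx i)}"
      using nb[OF that(1)] by (auto simp: neighbours_def)
    also have "\<dots> \<longleftrightarrow> j = pv i \<or> j = nx i"
      using that lt inj_on_eq_iff[OF inj] by simp
    \<comment> \<open>Two successor relations, one for each orientation, match the unordered pairs
      that define \<open>cycle_graph\<close>.\<close>
    also have "j = pv i \<longleftrightarrow> i = nx j"
      using that by (auto simp: pv_def nx_def mod_Suc)
    also have "(i = nx j \<or> j = nx i) \<longleftrightarrow> {i, j} \<in> edges (cycle_graph n)"
      using that by (auto simp: cycle_graph_def nx_def doubleton_eq_iff)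
    finally show ?thesis by simp
  qed
  \<comment> \<open>\<open>p\<close> runs from the indices to the graph, whereas
    \<open>is_cycle\<close> asks for an isomorphism in the opposite direction.\<close>
  moreover define q where "q = inv_into {..<n} p"
  ultimately have q: "bij_betw q (verts G) {..<n}" "\<And>v. v \<in> verts G \<Longrightarrow> p (q v) = v"
    and E: "\<And>i j. i < n \<Longrightarrow> j < n \<Longrightarrow> {i, j} \<in> edges (cycle_graph n) \<longleftrightarrow> {p i, p j} \<in> edges G"
    by (auto simp: bij_betw_inv_into bij_betw_inv_into_right)
  have "q v < n" if "v \<in> verts G" for v using bij_betwE[OF q(1)] that by auto
  then have "graph_iso q G (cycle_graph n)"
    unfolding graph_iso_def using q E by (simp add: cycle_graph_def)
  then show ?thesis unfolding is_cycle_def using n3 by blast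
qed

section \<open>Structure of subdivisions\<close>

lemma subdiv_point_simps [simp]:
  "subdiv_point k u v 0 = Original u"
  "k > 0 \<Longrightarrow> subdiv_point k u v k = Original v"
  by (auto simp: subdiv_point_def)

lemma subdiv_point_eq_Original:
  "subdiv_point k u v i = Original w \<longleftrightarrow> i = 0 \<and> w = u \<or> i \<noteq> 0 \<and> i = k \<and> w = v"
  by (auto simp: subdiv_point_def)

lemma inj_on_subdiv_point: "u \<noteq> v \<Longrightarrow> inj_on (subdiv_point k u v) {..k}"
  by (auto simp: inj_on_def subdiv_point_def doubleton_eq_iff split: if_splits)

lemma subdiv_point_in_verts:
  assumes "finite_simple_graph G" "{u, v} \<in> edges G" "i \<le> k"
  shows "subdiv_point k u v i \<in> verts (subdivision k G)"
proof (cases "i = 0 \<or> i = k")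
  case True
  then show ?thesis using edge_ends[OF assms(1,2)] by (auto simp: subdivision_def subdiv_point_def)
next
  case False
  then have "0 < i" "i < k" using assms(3) by auto
  then show ?thesis using assms(2) by (auto simp: subdivision_def)
qed

lemma verts_subdivision_cases:
  assumes "x \<in> verts (subdivision k G)"
  obtains (original) w where "w \<in> verts G" "x = Original w"
    | (point) u v i where "{u, v} \<in> edges G" "0 < i" "i < k" "x = subdiv_point k u v i"
  using assms by (auto simp: subdivision_def)

lemma Original_in_verts: "Original w \<in> verts (subdivision k G) \<longleftrightarrow> w \<in> verts G"
  by (auto simp: subdivision_def subdiv_point_def)

lemma edges_subdivision_iff:
  "e \<in> edges (subdivision k G) \<longleftrightarrow>
    (\<exists>u v i. {u, v} \<in> edges G \<and> i < k \<and> e = {subdiv_point k u v i, subdiv_point k u v (Suc i)})"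
  by (auto simp: subdivision_def)

lemma finite_simple_graph_subdivision:
  assumes "finite_simple_graph G"
  shows "finite_simple_graph (subdivision k G)"
proof -
  have "finite ((\<lambda>(u, v, i). subdiv_point k u v i) ` (verts G \<times> verts G \<times> {..<k}))"
    using assms by (auto simp: finite_simple_graph_def)
  then have "finite {subdiv_point k u v i | u v i. {u, v} \<in> edges G \<and> 0 < i \<and> i < k}"
    by (rule rev_finite_subset) (use edge_ends[OF assms] in \<open>auto simp: image_iff; blast\<close>)
  then have "finite (verts (subdivision k G))"
    using assms by (simp add: subdivision_def finite_simple_graph_def)
  moreover have "e \<subseteq> verts (subdivision k G) \<and> card e = 2" if e: "e \<in> edges (subdivision k G)" for e
  proof -
    obtain u v i where uv: "{u, v} \<in> edges G" "i < k"
      "e = {subdiv_point k u v i, subdiv_point k u v (Suc i)}"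
      using e by (auto simp: edges_subdivision_iff)
    moreover have "subdiv_point k u v i \<noteq> subdiv_point k u v (Suc i)"
      using inj_on_eq_iff[OF inj_on_subdiv_point[OF edge_ends(3)[OF assms uv(1)], of k], of i "Suc i"]
        uv(2) by simp
    ultimately show ?thesis using subdiv_point_in_verts[OF assms uv(1)] by simp
  qed
  ultimately show ?thesis by (simp add: finite_simple_graph_def)
qed

lemma subdiv_point_edge_reverse:
  assumes "i < k"
  shows "{subdiv_point k v u (k - Suc i), subdiv_point k v u (k - i)}
    = {subdiv_point k u v i, subdiv_point k u v (Suc i)}"
  using assms subdiv_point_reverse[of k i v u] subdiv_point_reverse[of k "Suc i" v u] by auto

text \<open>The name of an internal vertex determines its edge of \<open>G\<close> and its position
  up to reversal. Any edge of the subdivision at this vertex therefore lies on the same path, read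
  in one of the two orientations.\<close>

lemma neighbours_subdivision_internal:
  assumes G: "finite_simple_graph G" and uv: "{u, v} \<in> edges G" and i: "0 < i" "i < k"
  shows "neighbours (subdivision k G) (subdiv_point k u v i)
    = {subdiv_point k u v (i - 1), subdiv_point k u v (Suc i)}" (is "?L = ?R")
proof (intro equalityI subsetI)
  fix y assume "y \<in> ?R"
  moreover obtain j where "i = Suc j" using i by (cases i) auto
  ultimately show "y \<in> ?L" using uv i
    by (auto simp: neighbours_def edges_subdivision_iff insert_commute) (metis Suc_lessD)+
next
  fix y assume "y \<in> ?L"
  then obtain a b j where ab: "{a, b} \<in> edges G" "j < k"
    "{subdiv_point k u v i, y} = {subdiv_point k a b j, subdiv_point k a b (Suc j)}"
    by (auto simp: neighbours_def edges_subdivision_iff)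
  \<comment> \<open>This extends \<open>subdiv_point_internal_eq_iff\<close> to the ends
    \<open>l = 0\<close> and \<open>l = k\<close>, where both sides are false.\<close>
  have iff: "subdiv_point k u v i = subdiv_point k a b l \<longleftrightarrow>
    (u = a \<and> v = b \<and> i = l) \<or> (u = b \<and> v = a \<and> i = k - l)" if "l \<le> k" for l
  proof (cases "0 < l \<and> l < k")
    case True
    then show ?thesis using subdiv_point_internal_eq_iff edge_ends[OF G] uv ab i by metis
  next
    case False
    then have "l = 0 \<or> l = k" using that by auto
    then show ?thesis using i by (auto simp: subdiv_point_def)
  qed
  from ab(3) consider "subdiv_point k u v i = subdiv_point k a b j" "y = subdiv_point k a b (Suc j)"
    | "subdiv_point k u v i = subdiv_point k a b (Suc j)" "y = subdiv_point k a b j"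
    by (auto simp: doubleton_eq_iff)
  then show "y \<in> ?R"
  proof cases
    case 1
    then have "(u = a \<and> v = b \<and> i = j) \<or> (u = b \<and> v = a \<and> i = k - j)"
      using iff[of j] ab(2) by simp
    moreover have "k - j - 1 = k - Suc j" by simp
    ultimately show ?thesis
      using 1(2) ab(2) subdiv_point_reverse[of k "Suc j" b a] by auto
  next
    case 2
    then have "(u = a \<and> v = b \<and> i = Suc j) \<or> (u = b \<and> v = a \<and> i = k - Suc j)"
      using iff[of "Suc j"] ab(2) by simp
    moreover have "Suc (k - Suc j) = k - j" using ab(2) by simp
    ultimately show ?thesis
      using 2(2) ab(2) subdiv_point_reverse[of k j b a] by auto
  qed
qed

text \<open>A path that ends at \<open>w\<close> is reversed so that it starts there; its last edge
  then becomes its first.\<close>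

lemma neighbours_subdivision_Original:
  assumes "k > 0"
  shows "neighbours (subdivision k G) (Original w) = (\<lambda>v. subdiv_point k w v 1) ` neighbours G w"
    (is "?L = ?R")
proof (intro equalityI subsetI)
  fix y assume "y \<in> ?R"
  then show "y \<in> ?L" using assms
    by (auto simp: neighbours_def edges_subdivision_iff) (metis One_nat_def subdiv_point_simps(1))
next
  fix y assume "y \<in> ?L"
  then obtain a b j where ab: "{a, b} \<in> edges G" "j < k"
    "{Original w, y} = {subdiv_point k a b j, subdiv_point k a b (Suc j)}"
    by (auto simp: neighbours_def edges_subdivision_iff)
  from ab(3) consider "subdiv_point k a b j = Original w" "y = subdiv_point k a b (Suc j)"
    | "subdiv_point k a b (Suc j) = Original w" "y = subdiv_point k a b j"
    by (auto simp: doubleton_eq_iff)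
  then show "y \<in> ?R"
  proof cases
    case 1
    then show ?thesis
      using ab by (auto simp: subdiv_point_eq_Original neighbours_def)
  next
    case 2
    then have "Suc j = k" "w = b" using ab by (auto simp: subdiv_point_eq_Original)
    moreover have "subdiv_point k a b j = subdiv_point k b a 1"
      using \<open>Suc j = k\<close> subdiv_point_reverse[of k 1 a b] by auto
    ultimately show ?thesis
      using 2 ab by (auto simp: neighbours_def insert_commute)
  qed
qed

section \<open>Automorphisms\<close>

lemma automorphism_edge:
  assumes "finite_simple_graph G" "automorphism f G" "{x, y} \<in> edges G"
  shows "{f x, f y} \<in> edges G"
  using assms edge_ends[OF assms(1,3)] by (auto simp: graph_iso_def)

lemma automorphism_neighbours:
  assumes G: "finite_simple_graph G" and f: "automorphism f G" and x: "x \<in> verts G"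
  shows "neighbours G (f x) = f ` neighbours G x"
proof (intro equalityI subsetI)
  fix y assume y: "y \<in> neighbours G (f x)"
  then have "y \<in> verts G" using edge_ends[OF G] by (auto simp: neighbours_def)
  moreover have "f ` verts G = verts G" using f by (simp add: graph_iso_def bij_betw_def)
  ultimately obtain z where "z \<in> verts G" "y = f z" by blast
  then show "y \<in> f ` neighbours G x"
    using y x f by (auto simp: neighbours_def graph_iso_def)
qed (use automorphism_edge[OF G f] in \<open>auto simp: neighbours_def\<close>)

lemma automorphism_injD:
  assumes "automorphism f G" "x \<in> verts G" "y \<in> verts G" "f x = f y"
  shows "x = y"
  using assms by (auto simp: graph_iso_def bij_betw_def inj_on_def)

text \<open>On a finite graph an injective map of the vertices to themselves is onto, and so is the
  map it induces on the edges. Every edge is thus the image of an edge, which gives the reflection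
  of adjacency.\<close>

lemma automorphism_if_inj:
  assumes G: "finite_simple_graph G" and inj: "inj_on f (verts G)" and V: "f ` verts G \<subseteq> verts G"
    and E: "\<And>e. e \<in> edges G \<Longrightarrow> f ` e \<in> edges G"
  shows "automorphism f G"
proof -
  have "finite (verts G)" using G by (simp add: finite_simple_graph_def)
  then have "f ` verts G = verts G" using inj V by (simp add: endo_inj_surj)
  moreover have "inj_on ((`) f) (edges G)"
    using inj by (rule inj_on_subset[OF inj_on_image_Pow])
      (use G in \<open>auto simp: finite_simple_graph_def\<close>)
  then have sur: "(`) f ` edges G = edges G"
    using E finite_edges[OF G] by (intro endo_inj_surj) auto
  have "{u, v} \<in> edges G" if uv: "u \<in> verts G" "v \<in> verts G" "{f u, f v} \<in> edges G" for u v
  proof -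
    obtain e where "e \<in> edges G" "f ` e = f ` {u, v}"
      using sur uv(3) by (metis image_iff image_insert image_empty)
    moreover have "e \<subseteq> verts G" using G \<open>e \<in> edges G\<close> by (auto simp: finite_simple_graph_def)
    ultimately show ?thesis using inj_on_image_eq_iff[OF inj, of e "{u, v}"] uv by auto
  qed
  moreover have "{f u, f v} \<in> edges G" if "{u, v} \<in> edges G" for u v
    using E[OF that] by simp
  ultimately show ?thesis using inj unfolding graph_iso_def bij_betw_def by blast
qed

text \<open>The image of the first point after \<open>Original u\<close> is adjacent to
  \<open>Original u'\<close> and thereby selects \<open>v'\<close>. From then on each internal
  vertex offers only two neighbours, and injectivity forbids going back.\<close>

lemma automorphism_subdivision_path:
  assumes G: "finite_simple_graph G" and f: "automorphism f (subdivision k G)" and k: "k > 0"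
    and u: "f (Original u) = Original u'" and uv: "{u, v} \<in> edges G"
  obtains v' where "{u', v'} \<in> edges G" "\<And>i. i \<le> k \<Longrightarrow> f (subdiv_point k u v i) = subdiv_point k u' v' i"
proof -
  let ?H = "subdivision k G" and ?p = "subdiv_point k u v"
  note H = finite_simple_graph_subdivision[OF G, of k]
  have uV: "u \<in> verts G" and "u \<noteq> v" using edge_ends[OF G uv] by auto
  have "v \<in> neighbours G u" using uv by (simp add: neighbours_def)
  then have "?p 1 \<in> neighbours ?H (Original u)"
    unfolding neighbours_subdivision_Original[OF k] by blast
  then have "f (?p 1) \<in> neighbours ?H (Original u')"
    using automorphism_neighbours[OF H f, of "Original u"] uV u by (auto simp: Original_in_verts)
  then obtain v' where v': "{u', v'} \<in> edges G" "f (?p 1) = subdiv_point k u' v' 1"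
    unfolding neighbours_subdivision_Original[OF k] by (auto simp: neighbours_def)
  let ?q = "subdiv_point k u' v'"
  \<comment> \<open>Two consecutive positions are carried along, since the next image is found by
    excluding the previous one.\<close>
  have "Suc i \<le> k \<Longrightarrow> f (?p i) = ?q i \<and> f (?p (Suc i)) = ?q (Suc i)" for i
  proof (induction i)
    case 0
    then show ?case using u v' by simp
  next
    case (Suc i)
    have inV: "?p j \<in> verts ?H" if "j \<le> k" for j
      using subdiv_point_in_verts[OF G uv that] .
    have "?p (Suc (Suc i)) \<in> neighbours ?H (?p (Suc i))"
      using Suc.prems by (simp add: neighbours_subdivision_internal[OF G uv])
    then have "f (?p (Suc (Suc i))) \<in> neighbours ?H (?q (Suc i))"
      using automorphism_neighbours[OF H f inV, of "Suc i"] Suc by auto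
    then have "f (?p (Suc (Suc i))) = ?q i \<or> f (?p (Suc (Suc i))) = ?q (Suc (Suc i))"
      using Suc.prems by (simp add: neighbours_subdivision_internal[OF G v'(1)])
    moreover have "f (?p (Suc (Suc i))) \<noteq> ?q i"
    proof
      assume "f (?p (Suc (Suc i))) = ?q i"
      then have "f (?p (Suc (Suc i))) = f (?p i)" using Suc by simp
      then have "?p (Suc (Suc i)) = ?p i"
        using automorphism_injD[OF f inV inV] Suc.prems by simp
      then show False
        using inj_on_subdiv_point[OF \<open>u \<noteq> v\<close>, of k] Suc.prems by (auto dest: inj_onD)
    qed
    ultimately show ?case using Suc by simp
  qed
  then have "f (?p i) = ?q i" if "i \<le> k" for i
    using that u by (cases i) auto
  then show thesis using that v' by blast
qed

text \<open>Since \<open>G\<close> is not a cycle, it has a vertex of degree other than 2.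
  Subdividing keeps that degree, automorphisms preserve degrees, and internal vertices have degree
  2.\<close>

lemma automorphism_subdivision_some_Original:
  assumes G: "finite_simple_graph G" and con: "connected_graph G" and cyc: "\<not> is_cycle G"
    and f: "automorphism f (subdivision k G)" and k: "k \<ge> 2"
  obtains w w' where "w \<in> verts G" "f (Original w) = Original w'"
proof -
  let ?H = "subdivision k G"
  note H = finite_simple_graph_subdivision[OF G, of k]
  obtain w where w: "w \<in> verts G" "card (neighbours G w) \<noteq> 2"
    using two_regular_is_cycle[OF G con] cyc by blast
  have wH: "Original w \<in> verts ?H" using w by (simp add: Original_in_verts)
  have "f (Original w) \<in> verts ?H" using f wH by (auto simp: graph_iso_def bij_betw_def)
  then show thesis
  proof (cases rule: verts_subdivision_cases)
    case (original w')
    then show ?thesis using that w by blast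
  next
    case (point u v i)
    have "u \<noteq> v" using edge_ends[OF G point(1)] by simp
    then have "subdiv_point k u v (i - 1) \<noteq> subdiv_point k u v (Suc i)"
      using inj_on_subdiv_point[of u v k] point by (auto dest!: inj_onD)
    then have "card (neighbours ?H (f (Original w))) = 2"
      using neighbours_subdivision_internal[OF G point(1-3)] point(4) by simp
    moreover have "card (neighbours ?H (f (Original w))) = card (neighbours ?H (Original w))"
      unfolding automorphism_neighbours[OF H f wH]
    proof (rule card_image)
      have "neighbours ?H (Original w) \<subseteq> verts ?H" using edge_ends[OF H] by (auto simp: neighbours_def)
      then show "inj_on f (neighbours ?H (Original w))"
        using f inj_on_subset by (auto simp: graph_iso_def bij_betw_def)
    qed
    \<comment> \<open>Distinct paths leaving \<open>w\<close> have distinct first points, so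
      \<open>w\<close> keeps its degree.\<close>
    moreover have "inj_on (\<lambda>v. subdiv_point k w v 1) (neighbours G w)"
      using k edge_ends[OF G]
      by (auto simp: inj_on_def subdiv_point_def neighbours_def doubleton_eq_iff)
    then have "card (neighbours ?H (Original w)) = card (neighbours G w)"
      using k by (simp add: neighbours_subdivision_Original card_image)
    ultimately show ?thesis using w by simp
  qed
qed

text \<open>One original vertex with an original image suffices: following a path to its far end
  passes the property on to the adjacent vertex of \<open>G\<close>, and connectedness spreads it
  everywhere.\<close>

lemma automorphism_subdivision_induced:
  assumes G: "finite_simple_graph G" and con: "connected_graph G" and cyc: "\<not> is_cycle G"
    and f: "automorphism f (subdivision k G)" and k: "k \<ge> 2"
  obtains \<phi> where "inj_on \<phi> (verts G)" "\<phi> ` verts G \<subseteq> verts G"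
    "\<And>u. u \<in> verts G \<Longrightarrow> f (Original u) = Original (\<phi> u)"
    "\<And>u v. {u, v} \<in> edges G \<Longrightarrow> {\<phi> u, \<phi> v} \<in> edges G"
    "\<And>u v i. {u, v} \<in> edges G \<Longrightarrow> i \<le> k \<Longrightarrow> f (subdiv_point k u v i) = subdiv_point k (\<phi> u) (\<phi> v) i"
proof -
  obtain w w' where w: "w \<in> verts G" "f (Original w) = Original w'"
    using automorphism_subdivision_some_Original[OF assms] .
  have k0: "k > 0" using k by simp
  have "\<exists>u'. f (Original u) = Original u'" if "u \<in> verts G" for u
  proof (rule connected_graph_induct[OF con w(1) that, where P = "\<lambda>u. \<exists>u'. f (Original u) = Original u'"])
    fix x y assume "\<exists>x'. f (Original x) = Original x'" and xy: "{x, y} \<in> edges G"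
    then obtain x' where x': "f (Original x) = Original x'" by blast
    obtain y' where "\<And>i. i \<le> k \<Longrightarrow> f (subdiv_point k x y i) = subdiv_point k x' y' i"
      using automorphism_subdivision_path[OF G f k0 x' xy] by blast
    from this[of k] show "\<exists>y'. f (Original y) = Original y'" using k0 by simp
  qed (use w in blast)
  then obtain \<phi> where \<phi>: "\<And>u. u \<in> verts G \<Longrightarrow> f (Original u) = Original (\<phi> u)" by metis
  have path: "{\<phi> u, \<phi> v} \<in> edges G \<and>
      (\<forall>i\<le>k. f (subdiv_point k u v i) = subdiv_point k (\<phi> u) (\<phi> v) i)"
    if uv: "{u, v} \<in> edges G" for u v
  proof -
    have V: "u \<in> verts G" "v \<in> verts G" using edge_ends[OF G uv] by auto
    obtain v' where v': "{\<phi> u, v'} \<in> edges G"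
      "\<And>i. i \<le> k \<Longrightarrow> f (subdiv_point k u v i) = subdiv_point k (\<phi> u) v' i"
      using automorphism_subdivision_path[OF G f k0 \<phi>[OF V(1)] uv] by blast
    \<comment> \<open>The position \<open>i = k\<close> is the end \<open>Original v\<close>, whose
      image is already known.\<close>
    have "v' = \<phi> v" using v'(2)[of k] \<phi>[OF V(2)] k0 by simp
    then show ?thesis using v' by blast
  qed
  have "\<phi> u \<in> verts G" if "u \<in> verts G" for u
    using f \<phi>[OF that] that unfolding graph_iso_def
    by (metis Original_in_verts bij_betwE)
  moreover have "inj_on \<phi> (verts G)"
  proof (rule inj_onI)
    fix u v assume "u \<in> verts G" "v \<in> verts G" "\<phi> u = \<phi> v"
    then show "u = v"
      using automorphism_injD[OF f, of "Original u" "Original v"] \<phi> by (auto simp: Original_in_verts)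
  qed
  ultimately show thesis using that \<phi> path by blast
qed

text \<open>Renames the ends in the name of an internal vertex and keeps the distances. The map does
  not depend on \<open>k\<close>, so one \<open>\<phi>\<close> acts on all subdivisions at
  once.\<close>

fun subdiv_map :: "('a \<Rightarrow> 'b) \<Rightarrow> 'a subdiv_vertex \<Rightarrow> 'b subdiv_vertex" where
  "subdiv_map \<phi> (Original v) = Original (\<phi> v)"
| "subdiv_map \<phi> (Internal S) = Internal (map_prod \<phi> id ` S)"

lemma subdiv_map_point [simp]:
  "subdiv_map \<phi> (subdiv_point k u v i) = subdiv_point k (\<phi> u) (\<phi> v) i"
  by (simp add: subdiv_point_def)

lemma automorphism_subdiv_map:
  assumes G: "finite_simple_graph G" and inj: "inj_on \<phi> (verts G)" and V: "\<phi> ` verts G \<subseteq> verts G"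
    and E: "\<And>u v. {u, v} \<in> edges G \<Longrightarrow> {\<phi> u, \<phi> v} \<in> edges G"
  shows "automorphism (subdiv_map \<phi>) (subdivision k G)"
proof (rule automorphism_if_inj[OF finite_simple_graph_subdivision[OF G]])
  show "subdiv_map \<phi> ` verts (subdivision k G) \<subseteq> verts (subdivision k G)"
  proof (rule image_subsetI)
    fix x assume "x \<in> verts (subdivision k G)"
    then show "subdiv_map \<phi> x \<in> verts (subdivision k G)"
      by (cases rule: verts_subdivision_cases)
        (use V E subdiv_point_in_verts[OF G] in \<open>auto simp: Original_in_verts\<close>)
  qed
  show "subdiv_map \<phi> ` e \<in> edges (subdivision k G)" if "e \<in> edges (subdivision k G)" for e
    using that E unfolding edges_subdivision_iff by fastforce
  \<comment> \<open>\<open>\<phi>\<close> is injective only on \<open>verts G\<close>, so names of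
    internal vertices must be known to mention no other vertices.\<close>
  have sub: "S \<subseteq> verts G \<times> UNIV" if "Internal S \<in> verts (subdivision k G)" for S
    using that edge_ends[OF G] by (auto simp: subdivision_def subdiv_point_def split: if_splits)
  have "inj_on (map_prod \<phi> id) (verts G \<times> (UNIV :: nat set))"
    using inj by (simp add: map_prod_inj_on)
  note I = inj_on_image_eq_iff[OF this]
  show "inj_on (subdiv_map \<phi>) (verts (subdivision k G))"
  proof (rule inj_onI)
    fix x y
    assume xy: "x \<in> verts (subdivision k G)" "y \<in> verts (subdivision k G)"
      "subdiv_map \<phi> x = subdiv_map \<phi> y"
    then show "x = y"
      using inj I sub by (cases x; cases y) (auto simp: Original_in_verts dest: inj_onD)
  qed
qed

section \<open>Transferring the labeling\<close>

text \<open>An internal vertex is the only common end of two consecutive edges of its path, hence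
  fixed; an original vertex is the other end of an edge to a fixed internal vertex. The bound
  \<open>k \<ge> 2\<close> matters: swapping the ends of a single edge fixes it as a set.\<close>

lemma automorphism_trivial_if_fixes_edges:
  assumes G: "finite_simple_graph G" and nb: "\<And>w. w \<in> verts G \<Longrightarrow> neighbours G w \<noteq> {}"
    and k: "k \<ge> 2" and fix_edge: "\<And>e. e \<in> edges (subdivision k G) \<Longrightarrow> f ` e = e"
  shows "trivial_on f (subdivision k G)"
proof -
  have internal: "f (subdiv_point k u v i) = subdiv_point k u v i"
    if uv: "{u, v} \<in> edges G" and i: "0 < i" "i < k" for u v i
  proof -
    let ?p = "subdiv_point k u v"
    obtain j where j: "i = Suc j" using i by (cases i) auto
    have "u \<noteq> v" using edge_ends[OF G uv] by simp
    then have ne: "?p j \<noteq> ?p (Suc (Suc j))"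
      using inj_on_subdiv_point[of u v k] i j by (auto dest!: inj_onD)
    have e: "f ` {?p l, ?p (Suc l)} = {?p l, ?p (Suc l)}" if "l < k" for l
      by (rule fix_edge) (use uv that in \<open>auto simp: edges_subdivision_iff\<close>)
    have "f (?p i) \<in> {?p j, ?p (Suc j)}"
      using equalityD1[OF e[of j]] i by (simp add: j)
    moreover have "f (?p i) \<in> {?p (Suc j), ?p (Suc (Suc j))}"
      using equalityD1[OF e[of "Suc j"]] i by (simp add: j)
    ultimately show ?thesis using ne j by auto
  qed
  have "f (Original w) = Original w" if w: "w \<in> verts G" for w
  proof -
    obtain v where v: "{w, v} \<in> edges G" using nb[OF w] by (auto simp: neighbours_def)
    have "f ` {Original w, subdiv_point k w v 1} = {Original w, subdiv_point k w v 1}"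
    proof (rule fix_edge)
      show "{Original w, subdiv_point k w v 1} \<in> edges (subdivision k G)"
        unfolding edges_subdivision_iff
        by (intro exI[of _ w] exI[of _ v] exI[of _ 0]) (use v k in auto)
    qed
    then show ?thesis using internal[OF v, of 1] k by (auto simp: doubleton_eq_iff)
  qed
  then show ?thesis
    unfolding trivial_on_def using internal by (metis verts_subdivision_cases)
qed

text \<open>The \<open>LEAST\<close> in \<open>distinguishing_index\<close> has a meaning once some
  distinguishing labeling exists. Under \<open>rigid\<close>, giving all edges different labels is
  one.\<close>

lemma distinguishing_index_attained:
  assumes G: "finite_simple_graph G"
    and rigid: "\<And>f. automorphism f G \<Longrightarrow> (\<And>e. e \<in> edges G \<Longrightarrow> f ` e = e) \<Longrightarrow> trivial_on f G"
  obtains c where "c \<in> edges G \<rightarrow> {1..distinguishing_index G}" "distinguishing_edge_labeling G c"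
proof -
  obtain h where h: "bij_betw h (edges G) {1..card (edges G)}"
    using finite_same_card_bij[OF finite_edges[OF G], of "{1..card (edges G)}"] by auto
  have "trivial_on f G" if f: "automorphism f G" and c: "\<forall>e\<in>edges G. h (f ` e) = h e" for f
  proof (rule rigid[OF f])
    fix e assume e: "e \<in> edges G"
    obtain u v where "e = {u, v}" by (rule edge_obtain[OF G e])
    then have "f ` e \<in> edges G" using automorphism_edge[OF G f] e by auto
    then show "f ` e = e" using c e h by (auto simp: bij_betw_def dest: inj_onD)
  qed
  then have "distinguishing_edge_labeling G h"
    by (auto simp: distinguishing_edge_labeling_def)
  moreover have "h \<in> edges G \<rightarrow> {1..card (edges G)}" using h by (auto simp: bij_betw_def)
  ultimately have "\<exists>c \<in> edges G \<rightarrow> {1..distinguishing_index G}. distinguishing_edge_labeling G c"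
    unfolding distinguishing_index_def
    by (intro LeastI[where P = "\<lambda>d. \<exists>c \<in> edges G \<rightarrow> {1..d}. distinguishing_edge_labeling G c"]) auto
  then show thesis using that by blast
qed

text \<open>Here \<open>k\<close> belongs to the subdivision whose edges \<open>c\<close> labels;
  the vertices \<open>x\<close> are those of the \<open>Suc k\<close>-subdivision.
  \<open>SOME\<close> recovers the edge from the bare name of the vertex, which carries no
  orientation.\<close>

definition shifted_labeling :: "nat \<Rightarrow> 'a graph \<Rightarrow> ('a subdiv_vertex set \<Rightarrow> nat) \<Rightarrow> 'a subdiv_vertex \<Rightarrow> nat"
  where "shifted_labeling k G c x =
    (if x \<in> range Original then 1
     else c (SOME e. \<exists>u v i. {u, v} \<in> edges G \<and> i < k \<and> x = subdiv_point (Suc k) u v (Suc i)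
                \<and> e = {subdiv_point k u v i, subdiv_point k u v (Suc i)}))"

text \<open>The vertex has two presentations, by \<open>u\<close>, \<open>v\<close>,
  \<open>i\<close> and by \<open>v\<close>, \<open>u\<close>, \<open>k - Suc i\<close>. Both give
  the same edge of the \<open>k\<close>-subdivision, so the choice is unique.\<close>

lemma shifted_labeling_point:
  assumes G: "finite_simple_graph G" and uv: "{u, v} \<in> edges G" and i: "i < k"
  shows "shifted_labeling k G c (subdiv_point (Suc k) u v (Suc i))
    = c {subdiv_point k u v i, subdiv_point k u v (Suc i)}"
proof -
  let ?x = "subdiv_point (Suc k) u v (Suc i)"
  let ?e = "{subdiv_point k u v i, subdiv_point k u v (Suc i)}"
  have "?x \<notin> range Original" using i by (auto simp: subdiv_point_def)
  moreover have "(SOME e. \<exists>u v i. {u, v} \<in> edges G \<and> i < k \<and> ?x = subdiv_point (Suc k) u v (Suc i)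
      \<and> e = {subdiv_point k u v i, subdiv_point k u v (Suc i)}) = ?e"
  proof (rule some_equality)
    fix e assume "\<exists>a b j. {a, b} \<in> edges G \<and> j < k \<and> ?x = subdiv_point (Suc k) a b (Suc j)
      \<and> e = {subdiv_point k a b j, subdiv_point k a b (Suc j)}"
    then obtain a b j where ab: "{a, b} \<in> edges G" "j < k" "?x = subdiv_point (Suc k) a b (Suc j)"
      "e = {subdiv_point k a b j, subdiv_point k a b (Suc j)}" by blast
    have "(u = a \<and> v = b \<and> Suc i = Suc j) \<or> (u = b \<and> v = a \<and> Suc i = Suc k - Suc j)"
      using subdiv_point_internal_eq_iff[of u v a b "Suc i" "Suc k" "Suc j"]
        edge_ends(3)[OF G uv] edge_ends(3)[OF G ab(1)] i ab(2,3) by simp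
    then show "e = ?e"
    proof (elim disjE conjE)
      assume *: "u = b" "v = a" "Suc i = Suc k - Suc j"
      then have j: "j = k - Suc i" "Suc j = k - i" using i by auto
      have "e = {subdiv_point k v u j, subdiv_point k v u (Suc j)}"
        unfolding ab(4) *(1,2) ..
      also have "\<dots> = ?e"
        using subdiv_point_edge_reverse[OF i, of v u] by (simp only: j(2)) (simp only: j(1))
      finally show ?thesis .
    qed (use ab in simp)
  qed (use uv i in blast)
  ultimately show ?thesis by (simp add: shifted_labeling_def)
qed

lemma shifted_labeling_distinguishing:
  assumes G: "finite_simple_graph G" and con: "connected_graph G" and cyc: "\<not> is_cycle G"
    and k: "k \<ge> 1" and c: "distinguishing_edge_labeling (subdivision k G) c"
  shows "distinguishing_vertex_labeling (subdivision (Suc k) G) (shifted_labeling k G c)"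
  unfolding distinguishing_vertex_labeling_def
proof (intro notI, elim exE conjE)
  let ?H = "subdivision (Suc k) G" and ?c = "shifted_labeling k G c"
  fix f assume f: "automorphism f ?H" and nontriv: "\<not> trivial_on f ?H"
    and pres: "\<forall>v\<in>verts ?H. ?c (f v) = ?c v"
  have k2: "Suc k \<ge> 2" using k by simp
  obtain \<phi> where \<phi>: "inj_on \<phi> (verts G)" "\<phi> ` verts G \<subseteq> verts G"
    "\<And>u. u \<in> verts G \<Longrightarrow> f (Original u) = Original (\<phi> u)"
    "\<And>u v. {u, v} \<in> edges G \<Longrightarrow> {\<phi> u, \<phi> v} \<in> edges G"
    "\<And>u v i. {u, v} \<in> edges G \<Longrightarrow> i \<le> Suc k \<Longrightarrow>
      f (subdiv_point (Suc k) u v i) = subdiv_point (Suc k) (\<phi> u) (\<phi> v) i"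
    using automorphism_subdivision_induced[OF G con cyc f k2] by blast
  have "c (subdiv_map \<phi> ` e) = c e" if "e \<in> edges (subdivision k G)" for e
  proof -
    obtain u v i where e: "{u, v} \<in> edges G" "i < k"
      "e = {subdiv_point k u v i, subdiv_point k u v (Suc i)}"
      using \<open>e \<in> _\<close> by (auto simp: edges_subdivision_iff)
    let ?x = "subdiv_point (Suc k) u v (Suc i)"
    \<comment> \<open>\<open>\<phi>\<close> moves the edge \<open>e\<close> and its corresponding
      vertex \<open>?x\<close> to the same position on the image path.\<close>
    have "c (subdiv_map \<phi> ` e) = ?c (f ?x)"
      using e \<phi>(4)[OF e(1)] \<phi>(5)[OF e(1), of "Suc i"] by (simp add: shifted_labeling_point[OF G])
    also have "\<dots> = ?c ?x"
      using pres subdiv_point_in_verts[OF G e(1), of "Suc i" "Suc k"] e(2) by simp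
    also have "\<dots> = c e" using e by (simp add: shifted_labeling_point[OF G])
    finally show ?thesis .
  qed
  moreover have "automorphism (subdiv_map \<phi>) (subdivision k G)"
    using G \<phi>(1,2,4) by (rule automorphism_subdiv_map)
  ultimately have "trivial_on (subdiv_map \<phi>) (subdivision k G)"
    using c by (auto simp: distinguishing_edge_labeling_def)
  then have id: "\<phi> u = u" if "u \<in> verts G" for u
    using that unfolding trivial_on_def by (metis Original_in_verts subdiv_map.simps(1) subdiv_vertex.inject(1))
  have "f x = x" if "x \<in> verts ?H" for x
    using that
  proof (cases rule: verts_subdivision_cases)
    case (original w)
    then show ?thesis using \<phi>(3) id by simp
  next
    case (point u v i)
    then show ?thesis using \<phi>(5)[OF point(1), of i] id edge_ends[OF G point(1)] by simp
  qed
  then show False using nontriv by (simp add: trivial_on_def)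
qed

theorem theorem4p1:
  fixes G :: "'a graph" and k :: nat
  assumes "finite_simple_graph G"
    and "connected_graph G"
    and "card (verts G) \<ge> 3"
    and "\<not> is_cycle G"
    and "k \<ge> 2"
  shows "distinguishing_number (subdivision (k + 1) G) \<le> distinguishing_index (subdivision k G)"
proof -
  note G = assms(1)
  have nb: "neighbours G w \<noteq> {}" if w: "w \<in> verts G" for w
  proof
    assume none: "neighbours G w = {}"
    \<comment> \<open>The property carried along edges is equality with \<open>w\<close>; the step
      is vacuous since \<open>w\<close> has no neighbour.\<close>
    have "x = w" if "x \<in> verts G" for x
      by (rule connected_graph_induct[OF assms(2) w that])
        (use none in \<open>auto simp: neighbours_def\<close>)
    then have "verts G \<subseteq> {w}" by blast
    then have "card (verts G) \<le> 1" using card_mono[of "{w}"] by simp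
    then show False using assms(3) by simp
  qed
  let ?d = "distinguishing_index (subdivision k G)"
  obtain c where c: "c \<in> edges (subdivision k G) \<rightarrow> {1..?d}"
    "distinguishing_edge_labeling (subdivision k G) c"
    using distinguishing_index_attained[OF finite_simple_graph_subdivision[OF G]]
      automorphism_trivial_if_fixes_edges[OF G nb assms(5)] by metis
  have edge: "{subdiv_point k u v i, subdiv_point k u v (Suc i)} \<in> edges (subdivision k G)"
    if "{u, v} \<in> edges G" "i < k" for u v i
    using that by (auto simp: edges_subdivision_iff)
  have "shifted_labeling k G c x \<in> {1..?d}" if "x \<in> verts (subdivision (Suc k) G)" for x
    using that
  proof (cases rule: verts_subdivision_cases)
    case (original w)
    then obtain v where "{w, v} \<in> edges G" using nb by (auto simp: neighbours_def)
    \<comment> \<open>The label 1 of an original vertex is admissible only if \<open>?d\<close> is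
      at least 1; an edge at \<open>w\<close> shows this, as \<open>c\<close> gives it a value in
      \<open>{1..?d}\<close>.\<close>
    then have "c {subdiv_point k w v 0, subdiv_point k w v (Suc 0)} \<in> {1..?d}"
      using c(1) edge assms(5) by fastforce
    then show ?thesis using original by (auto simp: shifted_labeling_def)
  next
    case (point u v i)
    then obtain j where "i = Suc j" "j < k" by (cases i) auto
    then show ?thesis using c(1) edge point shifted_labeling_point[OF G] by fastforce
  qed
  moreover have "distinguishing_vertex_labeling (subdivision (Suc k) G) (shifted_labeling k G c)"
    using shifted_labeling_distinguishing[OF assms(1,2,4) _ c(2)] assms(5) by simp
  ultimately show ?thesis
    unfolding distinguishing_number_def by (intro Least_le) auto
qed

end
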